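(* Let $X_1,X_2,\dots$ be any sequence of (possibly correlated) random variables with $\mathrm{Var}(X_i)<+\infty$ for $i=1,2,\dots$. Suppose that one of the following conditions is satisfied: (1) $\mathrm{Var}(X_n)\to0$ as $n\to+\infty$; (2) $\frac1n\sum_{i=1}^n\mathrm{Var}(X_i)\to0$ as $n\to+\infty$; (3) there exist $C>0$ and $0<s<1$ such that both (a) and (b) hold: (a) either $\big|\frac1n\sum_{i=1}^n\mathrm{Var}(X_i)\big|<C$ for all $n$, or $\big|\frac1n\sum_{i=1}^n\mathrm{Var}(X_i)\big|=O(n^s)$; (b) either $\big|\frac1n\sum_{1\le i<j\le n}\mathrm{Cov}(X_i,X_j)\big|<C$ for all $n$, or $\big|\frac1n\sum_{1\le i<j\le n}\mathrm{Cov}(X_i,X_j)\big|=O(n^s)$; (4) there is a constant $C>0$ such that $\mathrm{Var}(X_n)<C$ for all $n$, and $\mathrm{Cov}(X_k,X_l)\to0$ as $|k-l|\to+\infty$. Then for any $\varepsilon>0$, $$\lim_{n\to\infty}P\Big(\Big|\frac1n\sum_{i=1}^nX_i-\frac1n\sum_{i=1}^nE X_i\Big|<\varepsilon\Big)=1.$$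
   Context: Random variables are real-valued, defined on a common probability space with probability $P$, with finite expectation and variance. "Correlated" only means that no independence or uncorrelatedness is assumed. $E$, $\mathrm{Var}$, $\mathrm{Cov}$ denote expectation, variance and covariance. "$\mathrm{Cov}(X_k,X_l)\to0$ as $|k-l|\to+\infty$" means: for every $\eta>0$ there is $N$ such that $|\mathrm{Cov}(X_k,X_l)|<\eta$ whenever $|k-l|>N$. Here, for a nonnegative sequence $a_n$, the notation $a_n=O(n^s)$ means that $a_n$ is infinite of the same order as $n^s$ as $n\to\infty$, i.e. there are constants $0<c_1\le c_2$ with $c_1n^s\le a_n\le c_2n^s$ for all sufficiently large $n$. *)

theory Defs
  imports "HOL-Probability.Probability"
begin

definition covariance :: "'a measure \<Rightarrow> ('a \<Rightarrow> real) \<Rightarrow> ('a \<Rightarrow> real) \<Rightarrow> real" where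
  "covariance M X Y =
     prob_space.expectation M (\<lambda>\<omega>. (X \<omega> - prob_space.expectation M X) * (Y \<omega> - prob_space.expectation M Y))"

(* Sequences below are indexed from 1, as in X_1, X_2, ...; the value at index 0 is not used. *)

definition avg_variance :: "'a measure \<Rightarrow> (nat \<Rightarrow> 'a \<Rightarrow> real) \<Rightarrow> nat \<Rightarrow> real" where
  "avg_variance M X n = 1 / real n * (\<Sum>i = 1..n. prob_space.variance M (X i))"

definition avg_covariance :: "'a measure \<Rightarrow> (nat \<Rightarrow> 'a \<Rightarrow> real) \<Rightarrow> nat \<Rightarrow> real" where
  "avg_covariance M X n =
     1 / real n * (\<Sum>(i, j) \<in> {(i, j). 1 \<le> i \<and> i < j \<and> j \<le> n}. covariance M (X i) (X j))"

(* The alternative "= O(n^s)" means exact order n^s, bounded above and below: hence \<Theta>. *)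

definition bounded_or_order :: "real \<Rightarrow> real \<Rightarrow> (nat \<Rightarrow> real) \<Rightarrow> bool" where
  "bounded_or_order C s a \<longleftrightarrow>
     (\<forall>n\<ge>1. \<bar>a n\<bar> < C) \<or> (\<lambda>n. \<bar>a n\<bar>) \<in> \<Theta>(\<lambda>n. real n powr s)"

definition covariance_vanishes :: "'a measure \<Rightarrow> (nat \<Rightarrow> 'a \<Rightarrow> real) \<Rightarrow> bool" where
  "covariance_vanishes M X \<longleftrightarrow>
     (\<forall>\<eta>>0. \<exists>N::nat. \<forall>k\<ge>1. \<forall>l\<ge>1.
        \<bar>int k - int l\<bar> > int N \<longrightarrow> \<bar>covariance M (X k) (X l)\<bar> < \<eta>)"

end

theory Submission
  imports Defs
begin

text \<open>
  By Chebyshev's inequality it suffices that the second moment of the centred average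
  tends to 0. That moment equals both
  \<open>1/n\<^sup>2 \<Sum>\<^sub>i\<^sub>,\<^sub>j Cov(X\<^sub>i, X\<^sub>j)\<close> and
  \<open>1/n (avg_variance n + 2 avg_covariance n)\<close>, and by convexity of the square it is at most
  \<open>avg_variance n\<close>. The last bound settles (2), and with it (1) by Cesaro averaging; the second
  expression settles (3), as the bracket is \<open>O(n\<^sup>s)\<close> with \<open>s < 1\<close>. For (4), the pairs with
  \<open>|i - j| \<le> N\<close> contribute at most \<open>(2N + 1) C n\<close> to the double sum, and all others
  at most \<open>\<eta> n\<^sup>2\<close>.
\<close>

section \<open>Limits and finite sums of real numbers\<close>

text \<open>\<open>K\<close> may depend on \<eta> but not on \<open>n\<close>, so
  \<open>K / real n\<close> eventually drops below any positive bound. Both the Cesaro argument and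
  the estimate under vanishing covariances end in this shape.\<close>

lemma tendsto_zero_of_le_divide_plus:
  fixes a :: "nat \<Rightarrow> real"
  assumes "\<And>\<eta>. \<eta> > 0 \<Longrightarrow> \<exists>K. \<forall>n\<ge>1. \<bar>a n\<bar> \<le> K / real n + \<eta>"
  shows "a \<longlonglongrightarrow> 0"
proof (rule tendstoI)
  fix e :: real assume e: "e > 0"
  then obtain K where K: "\<And>n. n \<ge> 1 \<Longrightarrow> \<bar>a n\<bar> \<le> K / real n + e / 2"
    using assms[of "e / 2"] by auto
  have "(\<lambda>n. K / real n) \<longlonglongrightarrow> 0"
    by (rule lim_const_over_n)
  then have "\<forall>\<^sub>F n in sequentially. K / real n < e / 2"
    using e by (intro order_tendstoD(2)) auto
  with eventually_ge_at_top[of 1] show "\<forall>\<^sub>F n in sequentially. dist (a n) 0 < e"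
  proof eventually_elim
    case (elim n)
    then have "\<bar>a n\<bar> < e" using K[of n] by linarith
    then show ?case by (simp add: dist_real_def)
  qed
qed

text \<open>The terms before some \<open>N\<close> have a fixed total, and every later one is below
  \<eta> in modulus.\<close>

lemma Cesaro_mean_tendsto_zero:
  fixes f :: "nat \<Rightarrow> real"
  assumes "f \<longlonglongrightarrow> 0"
  shows "(\<lambda>n. 1 / real n * (\<Sum>i = 1..n. f i)) \<longlonglongrightarrow> 0"
proof (rule tendsto_zero_of_le_divide_plus)
  fix \<eta> :: real assume "\<eta> > 0"
  then obtain N where N: "\<And>n. n \<ge> N \<Longrightarrow> \<bar>f n\<bar> < \<eta>"
    using LIMSEQ_D[OF assms] by fastforce
  have "\<bar>1 / real n * (\<Sum>i = 1..n. f i)\<bar> \<le> (\<Sum>i<N. \<bar>f i\<bar>) / real n + \<eta>" if "n \<ge> 1" for n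
  proof -
    have "\<bar>\<Sum>i = 1..n. f i\<bar> \<le> (\<Sum>i = 1..n. \<bar>f i\<bar>)"
      by (rule sum_abs)
    also have "\<dots> \<le> (\<Sum>i = 1..n. (if i < N then \<bar>f i\<bar> else 0) + \<eta>)"
      using N \<open>\<eta> > 0\<close> by (intro sum_mono) (auto simp: not_less less_imp_le)
    also have "\<dots> = (\<Sum>i \<in> {1..n} \<inter> {..<N}. \<bar>f i\<bar>) + real n * \<eta>"
      by (simp add: sum.distrib sum.inter_restrict)
    \<comment> \<open>Enlarging the index set to \<open>{..<N}\<close> makes the first sum
      independent of \<open>n\<close>, as the constant \<open>K\<close> must be; the added terms are
      nonnegative.\<close>
    also have "\<dots> \<le> (\<Sum>i<N. \<bar>f i\<bar>) + real n * \<eta>"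
      by (intro add_right_mono sum_mono2) auto
    finally show ?thesis
      using that by (simp add: abs_mult field_simps)
  qed
  then show "\<exists>K. \<forall>n\<ge>1. \<bar>1 / real n * (\<Sum>i = 1..n. f i)\<bar> \<le> K / real n + \<eta>"
    by blast
qed

text \<open>The index square splits into its diagonal, the triangle \<open>?T\<close> above it and
  the mirror image of \<open>?T\<close> under \<open>prod.swap\<close>; by symmetry both triangles
  have the same sum.\<close>

lemma sum_symmetric_square:
  fixes f :: "nat \<Rightarrow> nat \<Rightarrow> real"
  assumes "\<And>i j. f i j = f j i"
  shows "(\<Sum>i = 1..n. \<Sum>j = 1..n. f i j) =
    (\<Sum>i = 1..n. f i i) + 2 * (\<Sum>(i, j) \<in> {(i, j). 1 \<le> i \<and> i < j \<and> j \<le> n}. f i j)"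
proof -
  let ?T = "{(i, j). 1 \<le> i \<and> i < j \<and> j \<le> n}"
  let ?D = "(\<lambda>i. (i, i)) ` {1..n}"
  have T: "finite ?T"
    by (rule finite_subset[of _ "{1..n} \<times> {1..n}"]) auto
  have "{1..n} \<times> {1..n} = ?D \<union> (?T \<union> prod.swap ` ?T)"
    by (auto simp: image_iff)
  moreover have "?D \<inter> (?T \<union> prod.swap ` ?T) = {}" "?T \<inter> prod.swap ` ?T = {}"
    by auto
  ultimately have "(\<Sum>(i, j) \<in> {1..n} \<times> {1..n}. f i j) =
      (\<Sum>(i, j) \<in> ?D. f i j) + ((\<Sum>(i, j) \<in> ?T. f i j) + (\<Sum>(i, j) \<in> prod.swap ` ?T. f i j))"
    using T by (simp add: sum.union_disjoint)
  moreover have "(\<Sum>(i, j) \<in> ?D. f i j) = (\<Sum>i = 1..n. f i i)"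
    by (subst sum.reindex) (auto simp: inj_on_def)
  moreover have "(\<Sum>(i, j) \<in> prod.swap ` ?T. f i j) = (\<Sum>(i, j) \<in> ?T. f i j)"
    by (subst sum.reindex) (auto simp: assms intro!: sum.cong)
  ultimately show ?thesis
    by (simp add: sum.cartesian_product)
qed

text \<open>Each row meets the band around the diagonal in at most \<open>2 * N + 1\<close> places,
  which cost \<open>C\<close> each; the rest of the row costs at most
  \<open>real n * \<eta>\<close>.\<close>

lemma sum_band_le:
  fixes f :: "nat \<Rightarrow> nat \<Rightarrow> real"
  assumes C: "\<And>i j. i \<ge> 1 \<Longrightarrow> j \<ge> 1 \<Longrightarrow> f i j \<le> C" "C \<ge> 0"
    and \<eta>: "\<And>i j. i \<ge> 1 \<Longrightarrow> j \<ge> 1 \<Longrightarrow> \<bar>int i - int j\<bar> > int N \<Longrightarrow> f i j \<le> \<eta>" "\<eta> \<ge> 0"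
  shows "(\<Sum>i = 1..n. \<Sum>j = 1..n. f i j) \<le> real n * (real (2 * N + 1) * C + real n * \<eta>)"
proof -
  have "(\<Sum>j = 1..n. f i j) \<le> real (2 * N + 1) * C + real n * \<eta>" if i: "i \<in> {1..n}" for i
  proof -
    \<comment> \<open>Charging \<eta> inside the band too separates the two sums. For
      \<open>i < N\<close> the subtraction truncates to 0, which loses no index.\<close>
    have "(\<Sum>j = 1..n. f i j) \<le> (\<Sum>j = 1..n. (if j \<in> {i - N..i + N} then C else 0) + \<eta>)"
    proof (rule sum_mono)
      fix j assume j: "j \<in> {1..n}"
      show "f i j \<le> (if j \<in> {i - N..i + N} then C else 0) + \<eta>"
      proof (cases "j \<in> {i - N..i + N}")
        case True
        then show ?thesis using C(1)[of i j] i j \<eta>(2) by simp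
      next
        case False
        then have "\<bar>int i - int j\<bar> > int N" by auto
        then show ?thesis using \<eta>(1)[of i j] i j by (subst if_not_P[OF False]) simp
      qed
    qed
    also have "\<dots> = real (card ({1..n} \<inter> {i - N..i + N})) * C + real n * \<eta>"
      by (simp only: sum.distrib sum.inter_restrict[OF finite_atLeastAtMost, symmetric]) simp
    also have "card ({1..n} \<inter> {i - N..i + N}) \<le> card {i - N..i + N}"
      by (rule card_mono) auto
    then have "card ({1..n} \<inter> {i - N..i + N}) \<le> 2 * N + 1"
      by (rule order.trans) simp
    then have "real (card ({1..n} \<inter> {i - N..i + N})) * C + real n * \<eta>
        \<le> real (2 * N + 1) * C + real n * \<eta>"
      using C(2) by (intro add_right_mono mult_right_mono) simp_all
    finally show ?thesis .
  qed
  then have "(\<Sum>i = 1..n. \<Sum>j = 1..n. f i j) \<le> (\<Sum>i = 1..n. real (2 * N + 1) * C + real n * \<eta>)"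
    by (intro sum_mono) auto
  then show ?thesis by simp
qed

text \<open>A constant bound is absorbed because \<open>real n powr s\<close> is at least 1 for
  \<open>n \<ge> 1\<close>; exact order includes the upper bound. Both alternatives thus become one
  Landau statement.\<close>

lemma bounded_or_order_imp_bigo:
  assumes "bounded_or_order C s a" "s \<ge> 0"
  shows "a \<in> O(\<lambda>n. real n powr s)"
  using assms(1) unfolding bounded_or_order_def
proof
  assume C: "\<forall>n\<ge>1. \<bar>a n\<bar> < C"
  show ?thesis
  proof (rule bigoI[of _ C])
    show "\<forall>\<^sub>F n in sequentially. norm (a n) \<le> C * norm (real n powr s)"
      using eventually_ge_at_top[of 1]
    proof eventually_elim
      case (elim n)
      \<comment> \<open>The sign of \<open>C\<close> comes from the strict bound itself, since it
        exceeds an absolute value.\<close>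
      then have "\<bar>a n\<bar> \<le> C * 1" "C \<ge> 0" "1 \<le> real n powr s"
        using C assms(2) by (force simp: ge_one_powr_ge_zero)+
      then have "\<bar>a n\<bar> \<le> C * real n powr s"
        by (meson mult_left_mono order_trans)
      then show ?case by simp
    qed
  qed
next
  assume "(\<lambda>n. \<bar>a n\<bar>) \<in> \<Theta>(\<lambda>n. real n powr s)"
  then show ?thesis by (auto dest: bigthetaD1)
qed

section \<open>Integrability of products and basic facts on covariance\<close>

text \<open>The product is dominated by the sum of the two squares.\<close>

lemma integrable_mult_of_square_integrable:
  fixes f g :: "'a \<Rightarrow> real"
  assumes [measurable]: "f \<in> borel_measurable M" "g \<in> borel_measurable M"
    and "integrable M (\<lambda>x. (f x)\<^sup>2)" "integrable M (\<lambda>x. (g x)\<^sup>2)"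
  shows "integrable M (\<lambda>x. f x * g x)"
proof (rule Bochner_Integration.integrable_bound)
  show "integrable M (\<lambda>x. (f x)\<^sup>2 + (g x)\<^sup>2)"
    using assms by simp
  have "\<bar>f x * g x\<bar> \<le> (f x)\<^sup>2 + (g x)\<^sup>2" for x
  proof -
    have "2 * \<bar>f x * g x\<bar> \<le> (f x)\<^sup>2 + (g x)\<^sup>2"
      using sum_squares_bound[of "\<bar>f x\<bar>" "\<bar>g x\<bar>"] by (simp add: abs_mult)
    then show ?thesis
      using abs_ge_zero[of "f x * g x"] by linarith
  qed
  then show "AE x in M. norm (f x * g x) \<le> norm ((f x)\<^sup>2 + (g x)\<^sup>2)"
    by simp
qed measurable

lemma covariance_commute: "covariance M X Y = covariance M Y X"
  by (simp add: covariance_def mult.commute)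

lemma covariance_self: "covariance M X X = prob_space.variance M X"
  by (simp add: covariance_def power2_eq_square)

section \<open>The centred average and its second moment\<close>

text \<open>Finite variance is stated as integrability, because the Bochner integral of a
  non-integrable function is 0 by convention.\<close>

locale square_integrable_sequence = prob_space +
  fixes X :: "nat \<Rightarrow> 'a \<Rightarrow> real"
  assumes meas: "\<And>i. i \<ge> 1 \<Longrightarrow> X i \<in> borel_measurable M"
    and sq_int: "\<And>i. i \<ge> 1 \<Longrightarrow> integrable M (\<lambda>\<omega>. (X i \<omega> - expectation (X i))\<^sup>2)"
begin

definition dev :: "nat \<Rightarrow> 'a \<Rightarrow> real"
  where "dev i \<omega> = X i \<omega> - expectation (X i)"

definition mean_dev :: "nat \<Rightarrow> 'a \<Rightarrow> real"
  where "mean_dev n \<omega> = 1 / real n * (\<Sum>i = 1..n. dev i \<omega>)"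

lemma dev_measurable: "i \<ge> 1 \<Longrightarrow> dev i \<in> borel_measurable M"
  unfolding dev_def[abs_def] using meas by simp

lemma dev_square_integrable: "i \<ge> 1 \<Longrightarrow> integrable M (\<lambda>\<omega>. (dev i \<omega>)\<^sup>2)"
  unfolding dev_def using sq_int by simp

lemma dev_mult_integrable:
  "i \<ge> 1 \<Longrightarrow> j \<ge> 1 \<Longrightarrow> integrable M (\<lambda>\<omega>. dev i \<omega> * dev j \<omega>)"
  by (intro integrable_mult_of_square_integrable dev_measurable dev_square_integrable)

lemma covariance_eq_dev: "covariance M (X i) (X j) = expectation (\<lambda>\<omega>. dev i \<omega> * dev j \<omega>)"
  by (simp add: covariance_def dev_def)

lemma variance_eq_dev: "variance (X i) = expectation (\<lambda>\<omega>. (dev i \<omega>)\<^sup>2)"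
  by (simp add: dev_def)

text \<open>The inequality of arithmetic and geometric means is applied pointwise and integrated. It
  turns a uniform bound on the variances into the same bound on all covariances.\<close>

lemma abs_covariance_le:
  assumes "i \<ge> 1" "j \<ge> 1"
  shows "\<bar>covariance M (X i) (X j)\<bar> \<le> (variance (X i) + variance (X j)) / 2"
proof -
  have "\<bar>covariance M (X i) (X j)\<bar> \<le> expectation (\<lambda>\<omega>. \<bar>dev i \<omega> * dev j \<omega>\<bar>)"
    unfolding covariance_eq_dev by (rule integral_abs_bound)
  also have "\<dots> \<le> expectation (\<lambda>\<omega>. ((dev i \<omega>)\<^sup>2 + (dev j \<omega>)\<^sup>2) / 2)"
  proof (rule integral_mono)
    show "\<bar>dev i \<omega> * dev j \<omega>\<bar> \<le> ((dev i \<omega>)\<^sup>2 + (dev j \<omega>)\<^sup>2) / 2" for \<omega>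
      using sum_squares_bound[of "\<bar>dev i \<omega>\<bar>" "\<bar>dev j \<omega>\<bar>"] by (simp add: abs_mult)
  qed (use assms dev_mult_integrable dev_square_integrable in auto)
  also have "\<dots> = (variance (X i) + variance (X j)) / 2"
    using assms dev_square_integrable by (simp add: variance_eq_dev)
  finally show ?thesis .
qed

lemma mean_dev_square_eq:
  "(mean_dev n \<omega>)\<^sup>2 = 1 / (real n)\<^sup>2 * (\<Sum>i = 1..n. \<Sum>j = 1..n. dev i \<omega> * dev j \<omega>)"
  by (simp add: mean_dev_def power_mult_distrib power_divide power2_eq_square[of "sum _ _"] sum_product)

lemma mean_dev_measurable: "mean_dev n \<in> borel_measurable M"
  unfolding mean_dev_def[abs_def]
  by (intro borel_measurable_times borel_measurable_const borel_measurable_sum dev_measurable) auto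

lemma mean_dev_square_integrable: "integrable M (\<lambda>\<omega>. (mean_dev n \<omega>)\<^sup>2)"
  unfolding mean_dev_square_eq
  by (intro Bochner_Integration.integrable_mult_right Bochner_Integration.integrable_sum dev_mult_integrable) auto

lemma second_moment_mean_dev:
  "expectation (\<lambda>\<omega>. (mean_dev n \<omega>)\<^sup>2) =
    1 / (real n)\<^sup>2 * (\<Sum>i = 1..n. \<Sum>j = 1..n. covariance M (X i) (X j))"
proof -
  have "expectation (\<lambda>\<omega>. \<Sum>i = 1..n. \<Sum>j = 1..n. dev i \<omega> * dev j \<omega>) =
      (\<Sum>i = 1..n. \<Sum>j = 1..n. expectation (\<lambda>\<omega>. dev i \<omega> * dev j \<omega>))"
    by (subst Bochner_Integration.integral_sum)
      (auto intro!: sum.cong Bochner_Integration.integral_sum Bochner_Integration.integrable_sum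
        dev_mult_integrable)
  then show ?thesis
    by (simp add: mean_dev_square_eq covariance_eq_dev)
qed

text \<open>In the symmetric double sum the diagonal entries are the variances. One factor
  \<open>1 / real n\<close> goes into the averages, the other stays outside.\<close>

lemma second_moment_mean_dev_split:
  "expectation (\<lambda>\<omega>. (mean_dev n \<omega>)\<^sup>2) =
    1 / real n * (avg_variance M X n + 2 * avg_covariance M X n)"
  unfolding second_moment_mean_dev avg_variance_def avg_covariance_def
  by (subst sum_symmetric_square)
    (simp_all add: covariance_commute covariance_self power2_eq_square add_divide_distrib)

text \<open>The square of a sum of \<open>n\<close> terms is at most \<open>n\<close> times the sum
  of their squares; this holds pointwise, before integration. For \<open>n = 0\<close> both sides
  vanish.\<close>

lemma second_moment_mean_dev_le:
  "expectation (\<lambda>\<omega>. (mean_dev n \<omega>)\<^sup>2) \<le> avg_variance M X n"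
proof (cases "n = 0")
  case False
  have "expectation (\<lambda>\<omega>. (mean_dev n \<omega>)\<^sup>2) \<le>
      expectation (\<lambda>\<omega>. 1 / real n * (\<Sum>i = 1..n. (dev i \<omega>)\<^sup>2))"
  proof (rule integral_mono)
    show "integrable M (\<lambda>\<omega>. 1 / real n * (\<Sum>i = 1..n. (dev i \<omega>)\<^sup>2))"
      by (intro Bochner_Integration.integrable_mult_right Bochner_Integration.integrable_sum
          dev_square_integrable) auto
    show "(mean_dev n \<omega>)\<^sup>2 \<le> 1 / real n * (\<Sum>i = 1..n. (dev i \<omega>)\<^sup>2)" for \<omega>
      using sum_squared_le_sum_of_squares[of "\<lambda>i. dev i \<omega>" "{1..n}"] False
      by (simp add: mean_dev_def power_mult_distrib power_divide field_simps power2_eq_square)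
  qed (rule mean_dev_square_integrable)
  also have "\<dots> = avg_variance M X n"
    unfolding avg_variance_def variance_eq_dev
    by (simp add: Bochner_Integration.integral_sum dev_square_integrable)
  finally show ?thesis .
qed (simp add: mean_dev_def avg_variance_def)

section \<open>Vanishing of the second moment under the conditions\<close>

lemma second_moment_tendsto_zero_if_avg_variance:
  assumes "avg_variance M X \<longlonglongrightarrow> 0"
  shows "(\<lambda>n. expectation (\<lambda>\<omega>. (mean_dev n \<omega>)\<^sup>2)) \<longlonglongrightarrow> 0"
  by (rule tendsto_sandwich[OF _ _ tendsto_const assms])
    (auto simp: second_moment_mean_dev_le)

lemma second_moment_tendsto_zero_if_order:
  assumes "0 < s" "s < 1"
    and "bounded_or_order C s (avg_variance M X)" "bounded_or_order C s (avg_covariance M X)"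
  shows "(\<lambda>n. expectation (\<lambda>\<omega>. (mean_dev n \<omega>)\<^sup>2)) \<longlonglongrightarrow> 0"
proof -
  have "(\<lambda>n. avg_variance M X n + 2 * avg_covariance M X n) \<in> O(\<lambda>n. real n powr s)"
    using assms by (intro sum_in_bigo) (auto intro: bounded_or_order_imp_bigo)
  \<comment> \<open>Here \<open>s < 1\<close> enters: the bracket is of smaller order than
    \<open>n\<close>, so the outer factor \<open>1 / real n\<close> sends it to 0.\<close>
  also have "(\<lambda>n. real n powr s) \<in> o(\<lambda>n. real n powr 1)"
    using assms(2) by (intro powr_smallo_iff[THEN iffD2] filterlim_real_sequentially) auto
  finally have "(\<lambda>n. avg_variance M X n + 2 * avg_covariance M X n) \<in> o(\<lambda>n. real n)"
    by (simp add: powr_one)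
  from smalloD_tendsto[OF this] show ?thesis
    by (simp add: second_moment_mean_dev_split)
qed

lemma second_moment_tendsto_zero_if_covariance_vanishes:
  assumes C: "C > 0" "\<And>n. n \<ge> 1 \<Longrightarrow> variance (X n) < C"
    and "covariance_vanishes M X"
  shows "(\<lambda>n. expectation (\<lambda>\<omega>. (mean_dev n \<omega>)\<^sup>2)) \<longlonglongrightarrow> 0"
proof (rule tendsto_zero_of_le_divide_plus)
  fix \<eta> :: real assume \<eta>: "\<eta> > 0"
  then obtain N :: nat where N: "\<And>k l. k \<ge> 1 \<Longrightarrow> l \<ge> 1 \<Longrightarrow> \<bar>int k - int l\<bar> > int N \<Longrightarrow>
      \<bar>covariance M (X k) (X l)\<bar> < \<eta>"
    using assms(3) unfolding covariance_vanishes_def by metis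
  have "\<bar>expectation (\<lambda>\<omega>. (mean_dev n \<omega>)\<^sup>2)\<bar> \<le> real (2 * N + 1) * C / real n + \<eta>"
    if n: "n \<ge> 1" for n
  proof -
    \<comment> \<open>This is the bound used near the diagonal: the mean of two variances below
      \<open>C\<close>.\<close>
    have cov: "covariance M (X i) (X j) \<le> C" if "i \<ge> 1" "j \<ge> 1" for i j
      using order.trans[OF abs_ge_self abs_covariance_le[OF that]] C(2)[OF that(1)] C(2)[OF that(2)]
      by simp
    have "(\<Sum>i = 1..n. \<Sum>j = 1..n. covariance M (X i) (X j)) \<le>
        real n * (real (2 * N + 1) * C + real n * \<eta>)"
      using cov C(1) \<eta> N by (intro sum_band_le) (fastforce simp: abs_less_iff less_imp_le)+
    then have "expectation (\<lambda>\<omega>. (mean_dev n \<omega>)\<^sup>2) \<le>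
        1 / (real n)\<^sup>2 * (real n * (real (2 * N + 1) * C + real n * \<eta>))"
      unfolding second_moment_mean_dev by (intro mult_left_mono) auto
    also have "\<dots> = real (2 * N + 1) * C / real n + \<eta>"
      using n by (simp add: field_simps power2_eq_square)
    finally show ?thesis
      by simp
  qed
  then show "\<exists>K. \<forall>n\<ge>1. \<bar>expectation (\<lambda>\<omega>. (mean_dev n \<omega>)\<^sup>2)\<bar> \<le> K / real n + \<eta>"
    by blast
qed

section \<open>Chebyshev's inequality and the weak law\<close>

text \<open>Chebyshev bounds the complementary event by the second moment over the square of
  \<epsilon>, so the probability is squeezed between a sequence tending to 1 and the constant
  1.\<close>

lemma weak_law_if_second_moment_tendsto_zero:
  assumes lim: "(\<lambda>n. expectation (\<lambda>\<omega>. (mean_dev n \<omega>)\<^sup>2)) \<longlonglongrightarrow> 0" and "\<epsilon> > 0"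
  shows "(\<lambda>n. prob {\<omega> \<in> space M. \<bar>mean_dev n \<omega>\<bar> < \<epsilon>}) \<longlonglongrightarrow> 1"
proof (rule tendsto_sandwich)
  note [measurable] = mean_dev_measurable
  have "1 - expectation (\<lambda>\<omega>. (mean_dev n \<omega>)\<^sup>2) / \<epsilon>\<^sup>2 \<le> prob {\<omega> \<in> space M. \<bar>mean_dev n \<omega>\<bar> < \<epsilon>}" for n
  proof -
    have "prob {\<omega> \<in> space M. \<bar>mean_dev n \<omega>\<bar> < \<epsilon>} = 1 - prob {\<omega> \<in> space M. \<not> \<bar>mean_dev n \<omega>\<bar> < \<epsilon>}"
      by (subst prob_neg) simp_all
    moreover have "prob {\<omega> \<in> space M. \<bar>mean_dev n \<omega>\<bar> \<ge> \<epsilon>} \<le>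
        expectation (\<lambda>\<omega>. (mean_dev n \<omega>)\<^sup>2) / \<epsilon>\<^sup>2"
      using mean_dev_square_integrable assms(2) by (intro second_moment_method) auto
    ultimately show ?thesis
      by (simp add: not_less)
  qed
  then show "\<forall>\<^sub>F n in sequentially. 1 - expectation (\<lambda>\<omega>. (mean_dev n \<omega>)\<^sup>2) / \<epsilon>\<^sup>2
      \<le> prob {\<omega> \<in> space M. \<bar>mean_dev n \<omega>\<bar> < \<epsilon>}"
    by simp
  show "(\<lambda>n. 1 - expectation (\<lambda>\<omega>. (mean_dev n \<omega>)\<^sup>2) / \<epsilon>\<^sup>2) \<longlonglongrightarrow> 1"
    using tendsto_diff[OF tendsto_const tendsto_divide[OF lim tendsto_const], of "\<epsilon>\<^sup>2" 1] assms(2)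
    by simp
qed (auto intro: tendsto_const)

end

theorem theorem14:
  fixes M :: "'a measure" and X :: "nat \<Rightarrow> 'a \<Rightarrow> real" and \<epsilon> :: real
  assumes "prob_space M"
    and "\<And>i. i \<ge> 1 \<Longrightarrow> X i \<in> borel_measurable M"
    and "\<And>i. i \<ge> 1 \<Longrightarrow> integrable M (X i)"
    and "\<And>i. i \<ge> 1 \<Longrightarrow> integrable M (\<lambda>\<omega>. (X i \<omega> - prob_space.expectation M (X i))\<^sup>2)"
    and "(\<lambda>n. prob_space.variance M (X n)) \<longlonglongrightarrow> 0
       \<or> avg_variance M X \<longlonglongrightarrow> 0
       \<or> (\<exists>C>0. \<exists>s. 0 < s \<and> s < 1 \<and>
            bounded_or_order C s (avg_variance M X) \<and>
            bounded_or_order C s (avg_covariance M X))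
       \<or> ((\<exists>C>0. \<forall>n\<ge>1. prob_space.variance M (X n) < C) \<and> covariance_vanishes M X)"
    and "\<epsilon> > 0"
  shows "(\<lambda>n. measure M {\<omega> \<in> space M.
            \<bar>1 / real n * (\<Sum>i = 1..n. X i \<omega>)
             - 1 / real n * (\<Sum>i = 1..n. prob_space.expectation M (X i))\<bar> < \<epsilon>}) \<longlonglongrightarrow> 1"
proof -
  interpret prob_space M by fact
  interpret square_integrable_sequence M X
    by unfold_locales (use assms in auto)
  have "avg_variance M X \<longlonglongrightarrow> 0" if "(\<lambda>n. variance (X n)) \<longlonglongrightarrow> 0"
    using Cesaro_mean_tendsto_zero[OF that] by (simp add: avg_variance_def[abs_def])
  then have "(\<lambda>n. expectation (\<lambda>\<omega>. (mean_dev n \<omega>)\<^sup>2)) \<longlonglongrightarrow> 0"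
    using assms(5) second_moment_tendsto_zero_if_avg_variance second_moment_tendsto_zero_if_order
      second_moment_tendsto_zero_if_covariance_vanishes by blast
  from weak_law_if_second_moment_tendsto_zero[OF this \<open>\<epsilon> > 0\<close>] show ?thesis
    \<comment> \<open>Splitting the sum of deviations recovers the difference of the two
      averages.\<close>
    by (simp add: mean_dev_def dev_def sum_subtractf right_diff_distrib)
qed

end
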